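(* A connected signed graph with flexibility $\tau$ achieves at most $\binom{\tau+2}{2}$ Laplacian inertias.
   Context: A signed graph is a simple graph $G=(V(G),E(G))$ with vertex set $V(G)=\{1,\dots,n\}$ together with an assignment of a sign $+$ or $-$ to each edge. A consistent weighting $\gamma$ of $G$ assigns to each edge $ij$ a nonzero real number $\gamma_{ij}$ whose sign is the sign of the edge; $\Gamma=(G,\gamma)$ is then a weighted signed graph. Its Laplacian is $L(\Gamma)=A-D$, where $A=[a_{ij}]$ is the symmetric $n\times n$ matrix with $a_{ij}=\gamma_{ij}$ if $ij\in E(G)$ and $a_{ij}=0$ otherwise, and $D=\mathrm{diag}(d_1,\dots,d_n)$ with $d_i$ the sum of the weights of the edges incident to vertex $i$. The Laplacian inertia of $\Gamma$ is $IL(\Gamma)=(n_+,n_-,n_0)$, the numbers of positive, negative and zero eigenvalues of $L(\Gamma)$, counted with multiplicity. $G$ achieves a triple $(n_+,n_-,n_0)$ if $IL(G,\gamma)=(n_+,n_-,n_0)$ for some consistent weighting $\gamma$ of $G$; the number of Laplacian inertias of $G$ is the number of distinct triples it achieves. Let $c$ be the number of connected components of $G$, and let $c_+$ (resp. $c_-$) be the number of connected components of the spanning subgraph $G_+$ (resp. $G_-$) of $G$ consisting of all vertices and only the positive (resp. negative) edges. The flexibility of $G$ is $\tau=n+c-c_+-c_-$. *)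

theory Defs
  imports "Jordan_Normal_Form.Char_Poly"
begin

datatype edge_sign = Positive | Negative

text \<open>
  A signed graph on n vertices. The vertices are 0, ..., n - 1 (instead of 1, ..., n), matching
  the index range of n by n matrices. An edge is an unordered pair of distinct vertices. The sign
  function is only meaningful on the edges.
\<close>

record signed_graph =
  nverts :: nat
  edges :: "nat set set"
  sign_of :: "nat set \<Rightarrow> edge_sign"

definition vertices :: "signed_graph \<Rightarrow> nat set" where
  "vertices G = {0..<nverts G}"

definition is_signed_graph :: "signed_graph \<Rightarrow> bool" where
  "is_signed_graph G \<longleftrightarrow>
     (\<forall>e \<in> edges G. \<exists>i \<in> vertices G. \<exists>j \<in> vertices G. i \<noteq> j \<and> e = {i, j})"

definition pos_edges :: "signed_graph \<Rightarrow> nat set set" where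
  "pos_edges G = {e \<in> edges G. sign_of G e = Positive}"

definition neg_edges :: "signed_graph \<Rightarrow> nat set set" where
  "neg_edges G = {e \<in> edges G. sign_of G e = Negative}"


definition reachable :: "nat set set \<Rightarrow> (nat \<times> nat) set" where
  "reachable E = {(i, j). {i, j} \<in> E}\<^sup>*"

text \<open>
  Vertex sets of the connected components of the graph with vertex set V and edge set E.
\<close>

definition components :: "nat set \<Rightarrow> nat set set \<Rightarrow> nat set set" where
  "components V E = V // reachable E"

definition connected_graph :: "signed_graph \<Rightarrow> bool" where
  "connected_graph G \<longleftrightarrow>
     vertices G \<noteq> {} \<and>
     (\<forall>i \<in> vertices G. \<forall>j \<in> vertices G. (i, j) \<in> reachable (edges G))"

definition flexibility :: "signed_graph \<Rightarrow> int" where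
  "flexibility G =
     int (nverts G) + int (card (components (vertices G) (edges G)))
       - int (card (components (vertices G) (pos_edges G)))
       - int (card (components (vertices G) (neg_edges G)))"


definition consistent_weighting :: "signed_graph \<Rightarrow> (nat set \<Rightarrow> real) \<Rightarrow> bool" where
  "consistent_weighting G \<gamma> \<longleftrightarrow>
     (\<forall>e \<in> edges G. case sign_of G e of Positive \<Rightarrow> \<gamma> e > 0 | Negative \<Rightarrow> \<gamma> e < 0)"

definition weighted_adjacency :: "signed_graph \<Rightarrow> (nat set \<Rightarrow> real) \<Rightarrow> real mat" where
  "weighted_adjacency G \<gamma> =
     mat (nverts G) (nverts G) (\<lambda>(i, j). if {i, j} \<in> edges G then \<gamma> {i, j} else 0)"

definition weighted_degree :: "signed_graph \<Rightarrow> (nat set \<Rightarrow> real) \<Rightarrow> nat \<Rightarrow> real" where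
  "weighted_degree G \<gamma> i = (\<Sum>e \<in> {e \<in> edges G. i \<in> e}. \<gamma> e)"

text \<open>The sign convention is A - D, the negative of the more usual one.\<close>

definition laplacian :: "signed_graph \<Rightarrow> (nat set \<Rightarrow> real) \<Rightarrow> real mat" where
  "laplacian G \<gamma> = weighted_adjacency G \<gamma> - mat_diag (nverts G) (weighted_degree G \<gamma>)"


text \<open>
  Eigenvalues are counted with algebraic multiplicity. Only real eigenvalues are counted, which
  are all of them for a symmetric real matrix.
\<close>

definition count_eigenvalues :: "(real \<Rightarrow> bool) \<Rightarrow> real mat \<Rightarrow> nat" where
  "count_eigenvalues P A = (\<Sum>x | eigenvalue A x \<and> P x. Polynomial.order x (char_poly A))"

definition inertia :: "real mat \<Rightarrow> nat \<times> nat \<times> nat" where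
  "inertia A =
     (count_eigenvalues (\<lambda>x. x > 0) A,
      count_eigenvalues (\<lambda>x. x < 0) A,
      count_eigenvalues (\<lambda>x. x = 0) A)"

definition achieves :: "signed_graph \<Rightarrow> nat \<times> nat \<times> nat \<Rightarrow> bool" where
  "achieves G t \<longleftrightarrow> (\<exists>\<gamma>. consistent_weighting G \<gamma> \<and> inertia (laplacian G \<gamma>) = t)"

definition laplacian_inertias :: "signed_graph \<Rightarrow> (nat \<times> nat \<times> nat) set" where
  "laplacian_inertias G = {t. achieves G t}"

end

theory Submission
  imports Defs
begin

text \<open>
  Minus twice the quadratic form of L at x is the sum of a_ij (x_i - x_j)^2 over all ordered pairs
  (i, j), so the form is nonnegative on the vectors that are constant on each component of the
  positive subgraph. By connectedness only constant vectors are null there, so L is positive definite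
  on those vanishing on one fixed component. They form a space of dimension c_+ - 1, whence
  n_+ \<ge> c_+ - 1; likewise n_- \<ge> c_- - 1, and n_0 \<ge> 1 because constant vectors are in the kernel.
  The excesses over these three bounds are natural numbers with sum \<tau>, which leaves at most
  binomial(\<tau> + 2, 2) triples.
\<close>

section \<open>Spectral theorem for real symmetric matrices\<close>

text \<open>A Householder reflection does this: for w = u - e_0, the matrix I - 2 w w^T / |w|^2 is
  orthogonal and exchanges the unit vectors e_0 and u.\<close>

lemma orthogonal_mat_with_first_column:
  fixes u :: "real vec"
  assumes u: "u \<in> carrier_vec n" and norm: "u \<bullet> u = 1" and n: "0 < n"
  obtains W where "W \<in> carrier_mat n n" "transpose_mat W * W = 1\<^sub>m n" "col W 0 = u"
proof -
  define w where "w i = u $ i - (if i = 0 then 1 else 0)" for i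
  define s where "s = (\<Sum>k<n. (w k)\<^sup>2)"
  have norm': "(\<Sum>k<n. (u $ k)\<^sup>2) = 1"
    using norm u by (simp add: scalar_prod_def power2_eq_square lessThan_atLeast0)
  \<comment> \<open>Expanding |u - e_0|^2 with |u| = 1 gives 2 - 2 u_0, which is - 2 w_0. This
    relation is what makes the first column of the reflection equal to u.\<close>
  have "s = (\<Sum>k<n. (u $ k)\<^sup>2 + (if k = 0 then 1 - 2 * u $ 0 else 0))"
    unfolding s_def w_def by (intro sum.cong) (auto simp: power2_eq_square algebra_simps)
  also have "\<dots> = - 2 * w 0"
    using n norm' by (simp add: sum.distrib w_def)
  finally have sw: "s = - 2 * w 0" .
  show thesis
  proof (cases "s = 0")
    \<comment> \<open>Here u is already e_0, there is no reflection axis, and the identity matrix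
      serves.\<close>
    case True
    hence "w i = 0" if "i < n" for i
      using that unfolding s_def by (subst (asm) sum_nonneg_eq_0_iff) auto
    hence "u $ i = (if i = 0 then 1 else 0)" if "i < n" for i
      using that by (auto simp: w_def)
    hence "col (1\<^sub>m n) 0 = u"
      using u n by (intro eq_vecI) auto
    thus thesis by (intro that[of "1\<^sub>m n"]) auto
  next
    case False
    define W where "W = mat n n (\<lambda>(i, j). (if i = j then 1 else 0) - 2 * w i * w j / s)"
    have W: "W \<in> carrier_mat n n" by (simp add: W_def)
    have pull: "(\<Sum>k<n. c * (w k)\<^sup>2) = c * s" for c
      by (simp add: s_def sum_distrib_left)
    have "(transpose_mat W * W) $$ (i, j) = 1\<^sub>m n $$ (i, j)" if ij: "i < n" "j < n" for i j
    proof -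
      \<comment> \<open>\<open>c\<close> is the coefficient of the product of the two rank-one
        terms; summing \<open>(w k)\<^sup>2\<close> to \<open>s\<close> makes \<open>c * s\<close>
        cancel the two mixed terms.\<close>
      define c where "c = 4 * w i * w j / s\<^sup>2"
      have "(transpose_mat W * W) $$ (i, j) =
          (\<Sum>k<n. ((if k = i then 1 else 0) - 2 * w k * w i / s) *
                   ((if k = j then 1 else 0) - 2 * w k * w j / s))"
        using ij by (simp add: W_def scalar_prod_def lessThan_atLeast0)
      also have "\<dots> = (\<Sum>k<n. (if k = i then (if k = j then 1 else 0) - 2 * w i * w j / s else 0)
            - (if k = j then 2 * w i * w j / s else 0) + c * (w k)\<^sup>2)"
        by (intro sum.cong) (auto simp: c_def power2_eq_square algebra_simps)
      also have "\<dots> = (if i = j then 1 else 0) - 4 * w i * w j / s + c * s"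
        using ij by (simp add: sum.distrib sum_subtractf pull)
      also have "\<dots> = (if i = j then 1 else 0)"
        using False by (simp add: c_def power2_eq_square)
      finally show ?thesis using ij by simp
    qed
    hence "transpose_mat W * W = 1\<^sub>m n"
      using W by (intro eq_matI) auto
    moreover have "col W 0 = u"
    proof (intro eq_vecI)
      fix i assume i: "i < dim_vec u"
      have "col W 0 $ i = (if i = 0 then 1 else 0) - 2 * w i * w 0 / s"
        using i u n by (auto simp: W_def)
      also have "2 * w i * w 0 / s = - w i"
        using False by (simp add: sw)
      also have "(if i = 0 then 1 else 0) - - w i = u $ i"
        by (simp add: w_def)
      finally show "col W 0 $ i = u $ i" .
    qed (use u in \<open>auto simp: W_def\<close>)
    ultimately show thesis using W that by blast
  qed
qed

text \<open>The characteristic polynomial has a complex root z. With an eigenvector v, the number v*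
  A v = z |v|^2 is its own conjugate because A is real and symmetric, so z is real.\<close>

lemma symmetric_eigenvalue_exists:
  fixes A :: "real mat"
  assumes A: "A \<in> carrier_mat n n" and sym: "transpose_mat A = A" and n: "0 < n"
  obtains e where "eigenvalue A e"
proof -
  define C where "C = map_mat complex_of_real A"
  have C: "C \<in> carrier_mat n n" using A by (simp add: C_def)
  obtain as where as: "char_poly C = (\<Prod>a\<leftarrow>as. [:- a, 1:])" "length as = n"
    using char_poly_factorized[OF C] by blast
  then obtain z where "poly (char_poly C) z = 0"
    using n by (cases as) auto
  hence ev: "eigenvalue C z" using eigenvalue_root_char_poly[OF C] by blast
  then obtain v where v: "v \<in> carrier_vec n" "v \<noteq> 0\<^sub>v n" "C *\<^sub>v v = z \<cdot>\<^sub>v v"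
    using C by (auto simp: eigenvalue_def eigenvector_def)
  have Asym: "A $$ (i, j) = A $$ (j, i)" if "i < n" "j < n" for i j
    using that A arg_cong[OF sym, of "\<lambda>M. M $$ (i, j)"] by simp
  \<comment> \<open>\<open>q\<close> is the Hermitian form v* A v, and \<open>r\<close> is the
    squared norm of v.\<close>
  define q where "q = (\<Sum>i<n. \<Sum>j<n. cnj (v $ i) * of_real (A $$ (i, j)) * v $ j)"
  define r where "r = (\<Sum>i<n. (cmod (v $ i))\<^sup>2)"
  have "q = (\<Sum>i<n. cnj (v $ i) * (C *\<^sub>v v) $ i)"
    using v(1) A by (simp add: q_def C_def scalar_prod_def sum_distrib_left lessThan_atLeast0 mult.assoc)
  also have "\<dots> = (\<Sum>i<n. z * of_real ((cmod (v $ i))\<^sup>2))"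
    unfolding v(3) using v(1)
    by (intro sum.cong) (auto simp: complex_norm_square simp del: of_real_power)
  finally have qr: "q = z * of_real r"
    by (simp add: r_def sum_distrib_left)
  have "cnj q = (\<Sum>i<n. \<Sum>j<n. cnj (v $ j) * of_real (A $$ (j, i)) * v $ i)"
    unfolding q_def cnj_sum using Asym by (intro sum.cong refl) auto
  also have "\<dots> = q"
    unfolding q_def by (rule sum.swap)
  finally have "cnj q = q" .
  moreover have "r \<noteq> 0"
  proof
    assume "r = 0"
    hence "v $ i = 0" if "i < n" for i
      using that unfolding r_def by (subst (asm) sum_nonneg_eq_0_iff) auto
    hence "v = 0\<^sub>v n" using v(1) by (intro eq_vecI) auto
    with v(2) show False ..
  qed
  ultimately have "cnj z = z" unfolding qr by simp
  then obtain x where x: "z = complex_of_real x"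
    by (metis complex_cnj_cancel_iff Reals_cnj_iff Reals_cases)
  \<comment> \<open>The characteristic polynomial of the complexified matrix is the image of the
    real one, so the real number z is a root of the latter too.\<close>
  have "poly (map_poly complex_of_real (char_poly A)) z = 0"
    using ev unfolding eigenvalue_root_char_poly[OF C]
    unfolding C_def of_real_hom.char_poly_hom[OF A] .
  hence "poly (char_poly A) x = 0"
    unfolding x by simp
  thus thesis using that eigenvalue_root_char_poly[OF A] by blast
qed

text \<open>Deflation: a unit eigenvector is completed to an orthogonal W. The first column of W^T A
  W is then a multiple of e_0, by symmetry so is its first row, and the induction hypothesis
  diagonalizes the remaining block.\<close>

theorem symmetric_diagonalization:
  fixes A :: "real mat"
  assumes "A \<in> carrier_mat n n" and "transpose_mat A = A"
  shows "\<exists>P es. P \<in> carrier_mat n n \<and> transpose_mat P * P = 1\<^sub>m n \<and> length es = n \<and>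
    transpose_mat P * A * P = mat_diag n ((!) es)"
  using assms
proof (induction n arbitrary: A)
  case 0
  show ?case
    by (intro exI[of _ "1\<^sub>m 0"] exI[of _ "[]"]) (use 0 in \<open>auto simp: mat_diag_def intro!: eq_matI\<close>)
next
  case (Suc m A)
  note A = Suc.prems(1) and sym = Suc.prems(2)
  let ?n = "Suc m"
  obtain e where "eigenvalue A e"
    using symmetric_eigenvalue_exists[OF A sym] by blast
  then obtain v where v: "v \<in> carrier_vec ?n" "v \<noteq> 0\<^sub>v ?n" "A *\<^sub>v v = e \<cdot>\<^sub>v v"
    using A by (auto simp: eigenvalue_def eigenvector_def)
  have vv: "v \<bullet> v > 0"
  proof -
    obtain i where "i < ?n" "v $ i \<noteq> 0"
      using v(1,2) by (metis carrier_vecD eq_vecI index_zero_vec)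
    hence "(\<Sum>i<?n. (v $ i)\<^sup>2) > 0"
      by (intro sum_pos2[of _ i]) auto
    thus ?thesis
      using v(1) by (simp add: scalar_prod_def power2_eq_square lessThan_atLeast0)
  qed
  define u where "u = (1 / sqrt (v \<bullet> v)) \<cdot>\<^sub>v v"
  have u: "u \<in> carrier_vec ?n" using v(1) by (simp add: u_def)
  have uu: "u \<bullet> u = 1" using v(1) vv by (simp add: u_def)
  have Au: "A *\<^sub>v u = e \<cdot>\<^sub>v u"
    using v A by (simp add: u_def mult_mat_vec smult_smult_assoc mult.commute)
  obtain W where W: "W \<in> carrier_mat ?n ?n" "transpose_mat W * W = 1\<^sub>m ?n" "col W 0 = u"
    using orthogonal_mat_with_first_column[OF u uu] by blast
  define A' where "A' = transpose_mat W * A * W"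
  have A': "A' \<in> carrier_mat ?n ?n" using A W by (simp add: A'_def)
  have "transpose_mat A' = A'"
    using A W sym by (simp add: A'_def transpose_mult[of _ ?n ?n _ ?n] assoc_mult_mat[of _ ?n ?n _ ?n _ ?n])
  hence A'_sym: "A' $$ (i, j) = A' $$ (j, i)" if "i < ?n" "j < ?n" for i j
    using that A' index_transpose_mat(1)[of i A' j] by auto
  have "A' = transpose_mat W * (A * W)"
    using A W(1) by (simp add: A'_def assoc_mult_mat[of _ ?n ?n _ ?n _ ?n])
  hence "col A' 0 = transpose_mat W *\<^sub>v col (A * W) 0"
    by (simp only:) (rule col_mult2[of _ ?n ?n _ ?n], use A W(1) in auto)
  also have "col (A * W) 0 = A *\<^sub>v u"
    unfolding W(3)[symmetric] by (rule col_mult2[of _ ?n ?n _ ?n]) (use A W(1) in auto)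
  also have "transpose_mat W *\<^sub>v (A *\<^sub>v u) = e \<cdot>\<^sub>v (transpose_mat W *\<^sub>v col W 0)"
    using A W u by (simp add: Au mult_mat_vec[of _ ?n ?n])
  also have "transpose_mat W *\<^sub>v col W 0 = col (transpose_mat W * W) 0"
    by (rule col_mult2[symmetric, of _ ?n ?n _ ?n]) (use W in auto)
  also have "\<dots> = unit_vec ?n 0"
    unfolding W(2) by simp
  finally have "col A' 0 = e \<cdot>\<^sub>v unit_vec ?n 0" .
  hence A'_col: "A' $$ (i, 0) = (if i = 0 then e else 0)" if "i < ?n" for i
    using that A' by (metis (no_types, lifting) carrier_matD index_col index_smult_vec(1) index_unit_vec(1,3)
        mult.right_neutral mult_zero_right zero_less_Suc)
  define E where "E = mat 1 1 (\<lambda>_. e)"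
  define A3 where "A3 = mat m m (\<lambda>(i, j). A' $$ (Suc i, Suc j))"
  have E: "E \<in> carrier_mat 1 1" and A3: "A3 \<in> carrier_mat m m"
    by (simp_all add: E_def A3_def)
  have A'_block: "A' = four_block_mat E (0\<^sub>m 1 m) (0\<^sub>m m 1) A3"
  proof (rule eq_matI)
    fix i j assume "i < dim_row (four_block_mat E (0\<^sub>m 1 m) (0\<^sub>m m 1) A3)"
      and "j < dim_col (four_block_mat E (0\<^sub>m 1 m) (0\<^sub>m m 1) A3)"
    hence ij: "i < ?n" "j < ?n" using E A3 by auto
    thus "A' $$ (i, j) = four_block_mat E (0\<^sub>m 1 m) (0\<^sub>m m 1) A3 $$ (i, j)"
      using E A3 A'_col A'_sym[of 0 j] by (cases i; cases j) (auto simp: E_def A3_def)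
  qed (use A' E A3 in auto)
  have "transpose_mat A3 = A3"
    using A'_sym by (intro eq_matI) (auto simp: A3_def)
  then obtain P3 es where P3: "P3 \<in> carrier_mat m m" "transpose_mat P3 * P3 = 1\<^sub>m m"
      "length es = m" "transpose_mat P3 * A3 * P3 = mat_diag m ((!) es)"
    using Suc.IH[OF A3] by blast
  \<comment> \<open>The smaller orthogonal matrix is bordered by a 1, which leaves the split-off
    eigenvalue \<open>e\<close> untouched; the final change of basis is
    \<open>W * F\<close>.\<close>
  define F where "F = four_block_mat (1\<^sub>m 1) (0\<^sub>m 1 m) (0\<^sub>m m 1) P3"
  have F: "F \<in> carrier_mat ?n ?n" 
    using four_block_carrier_mat[of "1\<^sub>m 1" 1 1 P3 m m] P3 by (simp add: F_def)
  have FT: "transpose_mat F = four_block_mat (1\<^sub>m 1) (0\<^sub>m 1 m) (0\<^sub>m m 1) (transpose_mat P3)"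
    unfolding F_def by (subst transpose_four_block_mat) (use P3 in auto)
  have FF: "transpose_mat F * F = 1\<^sub>m ?n"
    unfolding FT unfolding F_def
    by (subst mult_four_block_mat[of _ 1 1 _ m _ m _ _ 1 _ m]) (use P3 in auto)
  have "transpose_mat F * A' = four_block_mat E (0\<^sub>m 1 m) (0\<^sub>m m 1) (transpose_mat P3 * A3)"
    unfolding FT A'_block
    by (subst mult_four_block_mat[of _ 1 1 _ m _ m _ _ 1 _ m]) (use P3 E A3 in auto)
  hence "transpose_mat F * A' * F =
      four_block_mat E (0\<^sub>m 1 m) (0\<^sub>m m 1) (transpose_mat P3 * A3) * F"
    by simp
  also have "\<dots> = four_block_mat E (0\<^sub>m 1 m) (0\<^sub>m m 1) (transpose_mat P3 * A3 * P3)"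
    unfolding F_def
    by (subst mult_four_block_mat[of _ 1 1 _ m _ m _ _ 1 _ m]) (use P3 E A3 in auto)
  also have "\<dots> = mat_diag ?n ((!) (e # es))"
    unfolding P3(4) by (intro eq_matI) (auto simp: mat_diag_def E_def nth_Cons split: nat.splits)
  finally have FAF: "transpose_mat F * A' * F = mat_diag ?n ((!) (e # es))" .
  define P where "P = W * F"
  have P: "P \<in> carrier_mat ?n ?n" using W F by (simp add: P_def)
  have "transpose_mat P * P = transpose_mat F * (transpose_mat W * W) * F"
    using W(1) F by (simp add: P_def transpose_mult[of _ ?n ?n _ ?n] assoc_mult_mat[of _ ?n ?n _ ?n _ ?n])
  hence PP: "transpose_mat P * P = 1\<^sub>m ?n"
    using W(2) F FF by simp
  have "transpose_mat P * A * P = transpose_mat F * A' * F"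
    using A W(1) F by (simp add: P_def A'_def transpose_mult[of _ ?n ?n _ ?n] assoc_mult_mat[of _ ?n ?n _ ?n _ ?n])
  with P PP FAF P3(3) show ?case
    by (intro exI[of _ P] exI[of _ "e # es"]) auto
qed

section \<open>Eigenvalue counts and quadratic forms\<close>

text \<open>The order of x as a root of the product of linear factors is the number of occurrences
  of x in \<open>es\<close>, so summing the orders over the eigenvalues satisfying \<open>Q\<close>
  counts list entries.\<close>

lemma count_eigenvalues_factored:
  assumes A: "A \<in> carrier_mat n n" and cp: "char_poly A = (\<Prod>e\<leftarrow>es. [:- e, 1:])"
  shows "count_eigenvalues Q A = length (filter Q es)"
proof -
  have ord: "Polynomial.order x (\<Prod>e\<leftarrow>es. [:- e, 1:]) = count_list es x" for x :: real and es
  proof (induction es)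
    case (Cons a es)
    have "(\<Prod>e\<leftarrow>a # es. [:- e, 1:]) \<noteq> 0"
      by (auto simp: prod_list_zero_iff simp del: mult_pCons_left)
    moreover have "Polynomial.order x [:- a, 1:] = (if a = x then 1 else 0)"
      using order_power_n_n[of x 1] by (auto intro: order_0I)
    ultimately show ?case
      using Cons by (auto simp: order_mult simp del: mult_pCons_left)
  qed simp
  have "{x. eigenvalue A x \<and> Q x} = set (filter Q es)"
    by (auto simp: eigenvalue_root_char_poly[OF A] cp poly_prod_list prod_list_zero_iff)
  hence "count_eigenvalues Q A = (\<Sum>x\<in>set (filter Q es). count_list es x)"
    by (simp add: count_eigenvalues_def cp ord)
  also have "\<dots> = (\<Sum>x\<in>set (filter Q es). count_list (filter Q es) x)"
    by (intro sum.cong) (auto simp: count_list_eq_length_filter filter_filter conj_commute intro!: arg_cong[of _ _ length] filter_cong)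
  also have "\<dots> = length (filter Q es)"
    by (rule sum_count_set) auto
  finally show ?thesis .
qed

text \<open>Padding the system with zero rows makes it square and singular, so its kernel is
  nontrivial.\<close>

lemma fewer_equations_nonzero_solution:
  fixes M :: "'a :: field mat"
  assumes M: "M \<in> carrier_mat m k" and mk: "m < k"
  obtains y where "y \<in> carrier_vec k" "y \<noteq> 0\<^sub>v k" "M *\<^sub>v y = 0\<^sub>v m"
proof -
  \<comment> \<open>Row \<open>m\<close> is the first padding row; it has a case of its own so that
    the term has the shape required by \<open>det_row_0\<close>.\<close>
  define N where "N = mat\<^sub>r k k (\<lambda>i. if i = m then 0\<^sub>v k else if i < m then row M i else 0\<^sub>v k)"
  have N: "N \<in> carrier_mat k k" by (simp add: N_def)
  have "det N = 0"
    unfolding N_def by (rule det_row_0[OF mk]) (use M in auto)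
  then obtain y where y: "y \<in> carrier_vec k" "y \<noteq> 0\<^sub>v k" "N *\<^sub>v y = 0\<^sub>v k"
    using det_0_iff_vec_prod_zero[OF N] by blast
  have "(M *\<^sub>v y) $ i = 0" if i: "i < m" for i
  proof -
    have "row N i = row M i"
      using i mk M by (intro eq_vecI) (auto simp: N_def)
    thus ?thesis
      using arg_cong[OF y(3), of "\<lambda>v. v $ i"] i mk M N by simp
  qed
  hence "M *\<^sub>v y = 0\<^sub>v m"
    using M by (intro eq_vecI) auto
  with y that show thesis by blast
qed

text \<open>One orthonormal eigenbasis yields both facts used later: A = P D P^T is similar to D, so
  the entries of \<open>es\<close> are the eigenvalues with multiplicity, and in the coordinates P^T
  x the form is a sum of squares weighted by them.\<close>

lemma symmetric_spectrum:
  fixes A :: "real mat"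
  assumes A: "A \<in> carrier_mat n n" and sym: "transpose_mat A = A"
  obtains P es where "P \<in> carrier_mat n n" "length es = n"
    "\<And>Q. count_eigenvalues Q A = length (filter Q es)"
    "\<And>x. x \<in> carrier_vec n \<Longrightarrow>
      x \<bullet> (A *\<^sub>v x) = (\<Sum>i<n. es ! i * ((transpose_mat P *\<^sub>v x) $ i)\<^sup>2)"
proof -
  obtain P es where P: "P \<in> carrier_mat n n" and PP: "transpose_mat P * P = 1\<^sub>m n"
    and es: "length es = n" and diag: "transpose_mat P * A * P = mat_diag n ((!) es)"
    using symmetric_diagonalization[OF A sym] by blast
  let ?D = "mat_diag n ((!) es)"
  have PT: "transpose_mat P \<in> carrier_mat n n" using P by simp
  have D: "?D \<in> carrier_mat n n" by simp
  have PP': "P * transpose_mat P = 1\<^sub>m n"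
    using mat_mult_left_right_inverse[OF PT P PP] .
  have "P * ?D * transpose_mat P = (P * transpose_mat P) * A * (P * transpose_mat P)"
    using P PT A by (simp add: diag[symmetric] assoc_mult_mat[of _ n n _ n _ n])
  hence decomp: "A = P * ?D * transpose_mat P"
    using A by (simp add: PP')
  have "similar_mat A ?D"
    by (rule similar_matI[of _ _ P "transpose_mat P" n]) (use A P PT D PP PP' decomp in auto)
  hence "char_poly A = char_poly ?D" by (rule char_poly_similar)
  also have "\<dots> = (\<Prod>e\<leftarrow>diag_mat ?D. [:- e, 1:])"
    by (rule char_poly_upper_triangular[OF D]) (auto simp: mat_diag_def)
  also have "diag_mat ?D = es"
    using es by (intro nth_equalityI) (auto simp: diag_mat_def mat_diag_def)
  finally have cp: "char_poly A = (\<Prod>e\<leftarrow>es. [:- e, 1:])" .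
  have "x \<bullet> (A *\<^sub>v x) = (\<Sum>i<n. es ! i * ((transpose_mat P *\<^sub>v x) $ i)\<^sup>2)"
    if x: "x \<in> carrier_vec n" for x
  proof -
    define z where "z = transpose_mat P *\<^sub>v x"
    have z: "z \<in> carrier_vec n" using P x by (simp add: z_def)
    have "A *\<^sub>v x = P *\<^sub>v (?D *\<^sub>v z)"
      using P PT D x by (subst decomp) (simp add: z_def assoc_mult_mat_vec[of _ n n _ n])
    hence "x \<bullet> (A *\<^sub>v x) = z \<bullet> (?D *\<^sub>v z)"
      using transpose_vec_mult_scalar[OF P _ x, of "?D *\<^sub>v z"] x mult_mat_vec_carrier[OF D z] by (simp add: z_def)
    also have "\<dots> = (\<Sum>i<n. es ! i * (z $ i)\<^sup>2)"
    proof -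
      have "(?D *\<^sub>v z) $ i = es ! i * z $ i" if "i < n" for i
      proof -
        have "(?D *\<^sub>v z) $ i = (\<Sum>j<n. (if i = j then es ! j else 0) * z $ j)"
          using z that by (simp add: scalar_prod_def mat_diag_def lessThan_atLeast0)
        also have "\<dots> = (\<Sum>j<n. if j = i then es ! i * z $ i else 0)"
          by (intro sum.cong) auto
        finally show ?thesis using that by simp
      qed
      thus ?thesis
        using carrier_vecD[OF mult_mat_vec_carrier[OF D z]]
        by (simp add: scalar_prod_def lessThan_atLeast0 power2_eq_square mult.left_commute
            del: index_mult_mat_vec dim_mult_mat_vec)
    qed
    finally show ?thesis by (simp add: z_def)
  qed
  with that[OF P es count_eigenvalues_factored[OF A cp]] show thesis by blast
qed

text \<open>Each of the n entries of the spectrum has exactly one of the three signs.\<close>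

lemma eigenvalue_count_sum:
  fixes A :: "real mat"
  assumes "A \<in> carrier_mat n n" and "transpose_mat A = A"
  shows "count_eigenvalues (\<lambda>x. x > 0) A + count_eigenvalues (\<lambda>x. x < 0) A
    + count_eigenvalues (\<lambda>x. x = 0) A = n"
proof -
  obtain P es where "length es = n" "\<And>Q. count_eigenvalues Q A = length (filter Q es)"
    using symmetric_spectrum[OF assms] by metis
  moreover have "length (filter (\<lambda>x. x > 0) es) + length (filter (\<lambda>x. x < 0) es)
      + length (filter (\<lambda>x. x = 0) es) = length es" for es :: "real list"
    by (induction es) auto
  ultimately show ?thesis by simp
qed

text \<open>This is the dimension argument behind Sylvester's law of inertia. With fewer than k
  eigenvalues of the given sign, some nonzero y makes all coordinates of S y along their
  eigenvectors vanish, and there the form cannot be definite. The factor \<open>s\<close> lets one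
  proof serve both signs.\<close>

lemma count_eigenvalues_ge_definite_dim:
  fixes A :: "real mat"
  assumes A: "A \<in> carrier_mat n n" and sym: "transpose_mat A = A"
    and S: "S \<in> carrier_mat n k"
    and definite: "\<And>y. y \<in> carrier_vec k \<Longrightarrow> y \<noteq> 0\<^sub>v k \<Longrightarrow>
      s * ((S *\<^sub>v y) \<bullet> (A *\<^sub>v (S *\<^sub>v y))) > 0"
  shows "k \<le> count_eigenvalues (\<lambda>x. s * x > 0) A"
proof (rule ccontr)
  obtain P es where P: "P \<in> carrier_mat n n" and es: "length es = n"
    and count: "\<And>Q. count_eigenvalues Q A = length (filter Q es)"
    and form: "\<And>x. x \<in> carrier_vec n \<Longrightarrow>
      x \<bullet> (A *\<^sub>v x) = (\<Sum>i<n. es ! i * ((transpose_mat P *\<^sub>v x) $ i)\<^sup>2)"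
    using symmetric_spectrum[OF A sym] by blast
  define I where "I = filter (\<lambda>i. s * es ! i > 0) [0..<n]"
  have "filter (\<lambda>x. s * x > 0) es = map ((!) es) I"
    by (subst map_nth[symmetric]) (simp add: filter_map I_def es o_def del: map_nth)
  hence len: "count_eigenvalues (\<lambda>x. s * x > 0) A = length I"
    by (simp add: count)
  assume "\<not> k \<le> count_eigenvalues (\<lambda>x. s * x > 0) A"
  hence less: "length I < k" by (simp add: len)
  let ?T = "transpose_mat P * S"
  have T: "?T \<in> carrier_mat n k" using P S by simp
  \<comment> \<open>The rows of P^T S that belong to the indices in \<open>I\<close>: M y = 0 says
    that S y is orthogonal to the corresponding eigenvectors.\<close>
  define M where "M = mat (length I) k (\<lambda>(r, j). ?T $$ (I ! r, j))"
  have M: "M \<in> carrier_mat (length I) k" by (simp add: M_def)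
  obtain y where y: "y \<in> carrier_vec k" "y \<noteq> 0\<^sub>v k" "M *\<^sub>v y = 0\<^sub>v (length I)"
    using fewer_equations_nonzero_solution[OF M less] by blast
  have zero: "(transpose_mat P *\<^sub>v (S *\<^sub>v y)) $ i = 0" if i: "i < n" "s * es ! i > 0" for i
  proof -
    have "i \<in> set I" using i by (simp add: I_def)
    then obtain r where r: "r < length I" "I ! r = i" by (auto simp: in_set_conv_nth)
    have "row M r = row ?T i"
      using r i T S P by (intro eq_vecI) (auto simp: M_def)
    hence "(?T *\<^sub>v y) $ i = (M *\<^sub>v y) $ r"
      using r i P T M by simp
    thus ?thesis
      using y r P S by (simp add: assoc_mult_mat_vec[of _ n n _ k])
  qed
  have "s * ((S *\<^sub>v y) \<bullet> (A *\<^sub>v (S *\<^sub>v y)))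
      = (\<Sum>i<n. (s * es ! i) * ((transpose_mat P *\<^sub>v (S *\<^sub>v y)) $ i)\<^sup>2)"
    using S y(1) by (subst form) (auto simp: sum_distrib_left mult.assoc)
  also have "\<dots> \<le> 0"
  proof (intro sum_nonpos)
    fix i assume "i \<in> {..<n}"
    thus "(s * es ! i) * ((transpose_mat P *\<^sub>v (S *\<^sub>v y)) $ i)\<^sup>2 \<le> 0"
      using zero[of i] by (cases "s * es ! i > 0") (auto intro: mult_nonpos_nonneg)
  qed
  finally show False using definite[OF y(1,2)] by simp
qed

section \<open>Connected components as equivalence classes\<close>

text \<open>The closure is reflexive on all natural numbers, so the carrier is \<open>UNIV\<close>
  and not the vertex set.\<close>

lemma equiv_reachable: "equiv UNIV (reachable E)"
proof -
  have "sym {(i, j). {i, j} \<in> E}"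
    by (auto simp: sym_def insert_commute)
  thus ?thesis
    unfolding reachable_def by (auto simp: equiv_def refl_rtrancl trans_rtrancl sym_rtrancl)
qed

lemma componentsE:
  assumes "C \<in> components V E"
  obtains i where "i \<in> V" "C = reachable E `` {i}"
  using assms by (auto simp: components_def quotient_def)

lemma component_disjoint:
  assumes "C \<in> components V E" "C' \<in> components V E" "i \<in> C" "i \<in> C'"
  shows "C = C'"
  using quotient_disj[OF equiv_reachable, of C E C'] assms
  by (auto simp: components_def quotient_def)

lemma component_closed:
  assumes "C \<in> components V E" "(i, j) \<in> reachable E"
  shows "i \<in> C \<longleftrightarrow> j \<in> C"
  using assms(1)
proof (rule componentsE)
  fix k assume "C = reachable E `` {k}"
  thus ?thesis
    using assms(2) equiv_reachable[of E] by (auto simp: equiv_def dest: symD transD)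
qed

lemma finite_components: "finite V \<Longrightarrow> finite (components V E)"
  unfolding components_def quotient_def by simp

section \<open>The Laplacian of a weighted signed graph\<close>

locale weighted_signed_graph =
  fixes G :: signed_graph and \<gamma> :: "nat set \<Rightarrow> real"
  assumes graph: "is_signed_graph G"
begin

abbreviation "n \<equiv> nverts G"
abbreviation "L \<equiv> laplacian G \<gamma>"

text \<open>Extending the weights by 0 to all pairs turns sums over edges into sums over vertices.
  The diagonal is 0 because a singleton is never an edge.\<close>

definition weight :: "nat \<Rightarrow> nat \<Rightarrow> real" where
  "weight i j = (if {i, j} \<in> edges G then \<gamma> {i, j} else 0)"

lemma weight_commute: "weight i j = weight j i"
  by (simp add: weight_def insert_commute)

lemma edge_vertices:
  assumes "{i, j} \<in> edges G"
  shows "i < n" "j < n" "i \<noteq> j"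
  using graph assms unfolding is_signed_graph_def vertices_def by (fastforce simp: doubleton_eq_iff)+

lemma weighted_degree_eq: "weighted_degree G \<gamma> i = (\<Sum>j<n. weight i j)"
proof -
  have "{e \<in> edges G. i \<in> e} = (\<lambda>j. {i, j}) ` {j. {i, j} \<in> edges G}"
    using graph unfolding is_signed_graph_def by (fastforce simp: insert_commute)
  hence "weighted_degree G \<gamma> i = (\<Sum>e\<in>(\<lambda>j. {i, j}) ` {j. {i, j} \<in> edges G}. \<gamma> e)"
    by (simp add: weighted_degree_def)
  also have "\<dots> = (\<Sum>j | {i, j} \<in> edges G. \<gamma> {i, j})"
    by (subst sum.reindex) (auto simp: inj_on_def doubleton_eq_iff)
  also have "\<dots> = (\<Sum>j<n. weight i j)"
    using edge_vertices(2) by (intro sum.mono_neutral_cong_left) (auto simp: weight_def)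
  finally show ?thesis .
qed

lemma laplacian_carrier: "L \<in> carrier_mat n n"
  unfolding laplacian_def weighted_adjacency_def by (intro minus_carrier_mat) simp

lemma laplacian_index:
  assumes "i < n" "j < n"
  shows "L $$ (i, j) = weight i j - (if i = j then \<Sum>k<n. weight i k else 0)"
  using assms by (simp add: laplacian_def weighted_adjacency_def mat_diag_def weight_def
      weighted_degree_eq[unfolded weight_def])

lemma laplacian_symmetric: "transpose_mat L = L"
  using laplacian_carrier by (intro eq_matI) (auto simp: laplacian_index weight_commute)

lemma laplacian_mult_vec:
  assumes "x \<in> carrier_vec n" "i < n"
  shows "(L *\<^sub>v x) $ i = (\<Sum>j<n. weight i j * (x $ j - x $ i))"
proof -
  have "(L *\<^sub>v x) $ i = (\<Sum>j<n. L $$ (i, j) * x $ j)"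
    using assms laplacian_carrier by (simp add: scalar_prod_def lessThan_atLeast0)
  also have "\<dots> = (\<Sum>j<n. weight i j * x $ j - (if j = i then (\<Sum>k<n. weight i k) * x $ i else 0))"
    using assms by (intro sum.cong) (auto simp: laplacian_index algebra_simps)
  also have "\<dots> = (\<Sum>j<n. weight i j * (x $ j - x $ i))"
    using assms by (simp add: sum_subtractf sum_distrib_right right_diff_distrib)
  finally show ?thesis .
qed

text \<open>The double sum for the form is added to its copy with i and j exchanged, and x_i (x_j -
  x_i) + x_j (x_i - x_j) = - (x_i - x_j)^2.\<close>

lemma laplacian_form:
  assumes x: "x \<in> carrier_vec n"
  shows "2 * (x \<bullet> (L *\<^sub>v x)) = - (\<Sum>i<n. \<Sum>j<n. weight i j * (x $ i - x $ j)\<^sup>2)"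
proof -
  let ?q = "x \<bullet> (L *\<^sub>v x)"
  have q1: "?q = (\<Sum>i<n. \<Sum>j<n. x $ i * (weight i j * (x $ j - x $ i)))"
    using x laplacian_carrier laplacian_mult_vec[OF x]
    by (simp add: scalar_prod_def lessThan_atLeast0 sum_distrib_left)
  also have "\<dots> = (\<Sum>j<n. \<Sum>i<n. x $ i * (weight i j * (x $ j - x $ i)))"
    by (rule sum.swap)
  finally have q2: "?q = (\<Sum>i<n. \<Sum>j<n. x $ j * (weight i j * (x $ i - x $ j)))"
    by (simp add: weight_commute)
  have "2 * ?q = ?q + ?q" by simp
  also have "\<dots> = (\<Sum>i<n. \<Sum>j<n. - (weight i j * (x $ i - x $ j)\<^sup>2))"
    by (subst q1, subst q2) (simp add: sum.distrib[symmetric] power2_eq_square algebra_simps)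
  finally show ?thesis by (simp add: sum_negf)
qed

lemma zero_eigenvalue_count:
  assumes "0 < n"
  shows "1 \<le> count_eigenvalues (\<lambda>x. x = 0) L"
proof -
  have "L *\<^sub>v vec n (\<lambda>_. 1) = 0 \<cdot>\<^sub>v vec n (\<lambda>_. 1)"
    using laplacian_carrier by (intro eq_vecI) (auto simp: laplacian_mult_vec simp del: index_mult_mat_vec)
  moreover have "vec n (\<lambda>_. 1 :: real) \<noteq> 0\<^sub>v n"
    using assms by (metis index_vec index_zero_vec(1) zero_neq_one)
  ultimately have ev: "eigenvalue L 0"
    using laplacian_carrier unfolding eigenvalue_def eigenvector_def
    by (intro exI[of _ "vec n (\<lambda>_. 1)"]) simp
  hence "{x. eigenvalue L x \<and> x = 0} = {0}" by auto
  \<comment> \<open>A root has positive order only in a nonzero polynomial; the characteristic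
    polynomial is monic.\<close>
  moreover have "char_poly L \<noteq> 0"
    using degree_monic_char_poly[OF laplacian_carrier] by auto
  hence "Polynomial.order 0 (char_poly L) \<noteq> 0"
    using ev by (simp add: eigenvalue_root_char_poly[OF laplacian_carrier] order_root)
  ultimately show ?thesis by (simp add: count_eigenvalues_def)
qed

text \<open>Stated for both signs at once: \<open>s = 1\<close> goes with the positive edges as
  \<open>E\<close>, and \<open>s = - 1\<close> with the negative ones. On vectors constant on the
  components of \<open>E\<close>, edges of \<open>E\<close> contribute nothing and all others
  contribute with the sign of \<open>s\<close>.\<close>

lemma components_le_count_eigenvalues:
  assumes conn: "connected_graph G" and s: "s \<noteq> 0" and sub: "E \<subseteq> edges G"
    and sign: "\<And>e. e \<in> edges G - E \<Longrightarrow> s * \<gamma> e < 0"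
  shows "card (components {0..<n} E) - 1 \<le> count_eigenvalues (\<lambda>x. s * x > 0) L"
proof -
  let ?\<C> = "components {0..<n} E"
  \<comment> \<open>One component, \<open>f ?k\<close> in the enumeration below, is kept aside for
    the value 0; this accounts for the - 1.\<close>
  let ?k = "card ?\<C> - 1"
  have fin: "finite ?\<C>" by (rule finite_components) simp
  then obtain f where f: "bij_betw f {0..<card ?\<C>} ?\<C>"
    using ex_bij_betw_nat_finite by blast
  have n: "0 < n" using conn by (auto simp: connected_graph_def vertices_def)
  hence "?\<C> \<noteq> {}" by (auto simp: components_def quotient_def)
  hence card: "card ?\<C> = Suc ?k" using fin by (simp add: card_gt_0_iff)
  have f_comp: "f r \<in> ?\<C>" if "r \<le> ?k" for r
    using that f card by (auto simp: bij_betw_def)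
  have f_inj: "r = r'" if "r \<le> ?k" "r' \<le> ?k" "i \<in> f r" "i \<in> f r'" for r r' i
    using component_disjoint[OF f_comp f_comp, of r r' i] that f card
    by (auto simp: bij_betw_def dest: inj_onD)
  have f_rep: "\<exists>i<n. i \<in> f r" if r: "r \<le> ?k" for r
  proof -
    obtain i where "i \<in> {0..<n}" "f r = reachable E `` {i}"
      using componentsE[OF f_comp[OF r]] by blast
    thus ?thesis by (auto simp: reachable_def)
  qed
  \<comment> \<open>The columns are the indicator vectors of all components but the last, so S y
    takes the value \<open>y $ r\<close> on \<open>f r\<close> and 0 on \<open>f ?k\<close>.\<close>
  define S :: "real mat" where "S = mat n ?k (\<lambda>(i, r). if i \<in> f r then 1 else 0)"
  have S: "S \<in> carrier_mat n ?k" by (simp add: S_def)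
  show ?thesis
  proof (rule count_eigenvalues_ge_definite_dim[OF laplacian_carrier laplacian_symmetric S])
    fix y :: "real vec" assume y: "y \<in> carrier_vec ?k" "y \<noteq> 0\<^sub>v ?k"
    define x where "x = S *\<^sub>v y"
    have x: "x \<in> carrier_vec n" unfolding x_def by (rule mult_mat_vec_carrier[OF S y(1)])
    have x_sum: "x $ i = (\<Sum>r<?k. (if i \<in> f r then 1 else 0) * y $ r)" if "i < n" for i
      using that y by (simp add: x_def S_def scalar_prod_def lessThan_atLeast0)
    have x_val: "x $ i = (if r < ?k then y $ r else 0)" if i: "i < n" "i \<in> f r" and r: "r \<le> ?k" for i r
    proof -
      have "x $ i = (\<Sum>r'<?k. if r' = r then y $ r else 0)"
        unfolding x_sum[OF i(1)] using f_inj[OF _ r _ i(2)] i(2) by (intro sum.cong) auto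
      thus ?thesis by simp
    qed
    have x_const: "x $ i = x $ j" if "i < n" "j < n" "{i, j} \<in> E" for i j
    proof -
      have "(i, j) \<in> reachable E" using that by (auto simp: reachable_def)
      hence "i \<in> f r \<longleftrightarrow> j \<in> f r" if "r < ?k" for r
        using component_closed[OF f_comp, of r] that by simp
      thus ?thesis using that by (simp add: x_sum)
    qed
    define h where "h i j = - s * (weight i j * (x $ i - x $ j)\<^sup>2)" for i j
    have nonneg: "h i j \<ge> 0" if "i < n" "j < n" for i j
    proof (cases "{i, j} \<in> edges G - E")
      case True
      hence "- s * weight i j \<ge> 0" using sign[OF True] by (simp add: weight_def)
      hence "(- s * weight i j) * (x $ i - x $ j)\<^sup>2 \<ge> 0" by (rule mult_nonneg_nonneg) simp
      thus ?thesis by (simp add: h_def mult.assoc)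
    qed (use that x_const in \<open>auto simp: h_def weight_def\<close>)
    have nonneg_sum: "(\<Sum>j<n. h i j) \<ge> 0" if "i < n" for i
      using nonneg that by (intro sum_nonneg) auto
    have form: "2 * (s * (x \<bullet> (L *\<^sub>v x))) = (\<Sum>i<n. \<Sum>j<n. h i j)" (is "_ = ?q")
      using arg_cong[OF laplacian_form[OF x], of "(*) s"]
      by (simp add: h_def sum_distrib_left sum_negf)
    \<comment> \<open>If the form vanishes, so does each nonnegative summand. Then x agrees across
      every edge: within \<open>E\<close> by construction, outside \<open>E\<close> because the
      weight is nonzero.\<close>
    have "?q \<noteq> 0"
    proof
      assume "?q = 0"
      hence "(\<Sum>j<n. h i j) = 0" if "i < n" for i
        using that nonneg_sum by (subst (asm) sum_nonneg_eq_0_iff) auto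
      hence zero: "h i j = 0" if "i < n" "j < n" for i j
        using that nonneg sum_nonneg_eq_0_iff[of "{..<n}" "h i"] by auto
      have edge: "x $ i = x $ j" if e: "{i, j} \<in> edges G" for i j
        using zero[OF edge_vertices(1,2)[OF e]] x_const[OF edge_vertices(1,2)[OF e]] s sign[of "{i, j}"] e
        by (cases "{i, j} \<in> E") (auto simp: h_def weight_def)
      have "x $ i = x $ j" if "(i, j) \<in> reachable (edges G)" for i j
        using that unfolding reachable_def by (induction rule: rtrancl_induct) (auto dest: edge)
      \<comment> \<open>By connectedness x is constant, and the component set aside forces the
        constant to be 0.\<close>
      moreover obtain j where "j < n" "j \<in> f ?k" using f_rep by blast
      moreover from this have "x $ j = 0" using x_val[of j ?k] by simp
      ultimately have x0: "x $ i = 0" if "i < n" for i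
        using conn that by (force simp: connected_graph_def vertices_def)
      have "y $ r = 0" if r: "r < ?k" for r
      proof -
        obtain i where "i < n" "i \<in> f r" using f_rep r by (metis less_imp_le)
        thus ?thesis using x_val[of i r] x0 r by simp
      qed
      hence "y = 0\<^sub>v ?k" using y(1) by (intro eq_vecI) auto
      with y(2) show False ..
    qed
    moreover have "?q \<ge> 0" by (rule sum_nonneg) (use nonneg_sum in auto)
    ultimately show "s * ((S *\<^sub>v y) \<bullet> (L *\<^sub>v (S *\<^sub>v y))) > 0"
      using form by (simp add: x_def)
  qed
qed

end

section \<open>Counting the admissible triples and assembling the bound\<close>

text \<open>Stars and bars: the excesses a - p, b - q and c - 1 sum to n - p - q - 1, so a triple
  corresponds to the positions of two bars among n - p - q + 1 places.\<close>

lemma card_triples_le: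
  fixes p q n :: nat
  defines "T \<equiv> {(a, b, c). p \<le> a \<and> q \<le> b \<and> 1 \<le> c \<and> a + b + c = n}"
  shows "finite T \<and> card T \<le> nat (int n - int p - int q + 1) choose 2"
proof (cases "p + q < n")
  \<comment> \<open>As c is at least 1, no triple fits when p + q reaches n.\<close>
  case False
  hence "T = {}" by (auto simp: T_def)
  thus ?thesis by simp
next
  case True
  define N where "N = n - p - q + 1"
  \<comment> \<open>The first bar stands after a - p stars, the second after b - q more; the + 1
    skips the first bar. The third component is determined by the sum.\<close>
  define g where "g = (\<lambda>(a, b, c :: nat). {a - p, a - p + (b - q) + 1})"
  let ?P = "{B. B \<subseteq> {0..<N} \<and> card B = 2}"
  have inj: "inj_on g T"
    by (auto simp: inj_on_def g_def T_def doubleton_eq_iff)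
  have sub: "g ` T \<subseteq> ?P"
    using True by (auto simp: g_def T_def N_def card_insert_if)
  have fin: "finite ?P" by simp
  have "finite T" using finite_imageD[OF finite_subset[OF sub fin] inj] .
  moreover have "card T \<le> card ?P" using card_inj_on_le[OF inj sub fin] .
  moreover have "card ?P = N choose 2" by (simp add: n_subsets)
  moreover have "N = nat (int n - int p - int q + 1)" using True by (simp add: N_def)
  ultimately show ?thesis by simp
qed

theorem lemma3p2:
  fixes G :: signed_graph
  assumes "is_signed_graph G" and "connected_graph G"
  shows "finite (laplacian_inertias G) \<and>
         card (laplacian_inertias G) \<le> nat (flexibility G + 2) choose 2"
proof -
  let ?V = "{0..<nverts G}"
  define cp where "cp = card (components ?V (pos_edges G))"
  define cn where "cn = card (components ?V (neg_edges G))"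
  let ?T = "{(a, b, c). cp - 1 \<le> a \<and> cn - 1 \<le> b \<and> 1 \<le> c \<and> a + b + c = nverts G}"
  have n: "0 < nverts G" using assms(2) by (auto simp: connected_graph_def vertices_def)
  have pos: "card (components ?V E) > 0" for E
    using n by (simp add: card_gt_0_iff finite_components) (auto simp: components_def quotient_def)
  \<comment> \<open>Connectedness makes all classes equal to that of vertex 0, so c = 1.\<close>
  have "components ?V (edges G) = (\<lambda>i. reachable (edges G) `` {i}) ` ?V"
    by (auto simp: components_def quotient_def)
  also have "\<dots> = (\<lambda>i. reachable (edges G) `` {0}) ` ?V"
  proof (rule image_cong)
    fix i assume "i \<in> ?V"
    hence "(i, 0) \<in> reachable (edges G)"
      using assms(2) n by (auto simp: connected_graph_def vertices_def)
    thus "reachable (edges G) `` {i} = reachable (edges G) `` {0}"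
      by (rule equiv_class_eq[OF equiv_reachable])
  qed simp
  also have "\<dots> = {reachable (edges G) `` {0}}" using n by auto
  \<comment> \<open>With c = 1, \<tau> + 2 = n - (c_+ - 1) - (c_- - 1) + 1. The truncated
    subtractions \<open>cp - 1\<close> and \<open>cn - 1\<close> are exact since both counts are
    positive.\<close>
  finally have flex: "flexibility G + 2 = int (nverts G) - int (cp - 1) - int (cn - 1) + 1"
    using pos[of "pos_edges G"] pos[of "neg_edges G"]
    by (simp add: flexibility_def cp_def cn_def vertices_def)
  have T: "finite ?T \<and> card ?T \<le> nat (flexibility G + 2) choose 2"
    unfolding flex by (rule card_triples_le)
  have "laplacian_inertias G \<subseteq> ?T"
  proof
    fix t assume "t \<in> laplacian_inertias G"
    then obtain \<gamma> where \<gamma>: "consistent_weighting G \<gamma>" and t: "t = inertia (laplacian G \<gamma>)"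
      by (auto simp: laplacian_inertias_def achieves_def)
    interpret weighted_signed_graph G \<gamma> by unfold_locales fact
    \<comment> \<open>The factors 1 and - 1 match the parameter \<open>s\<close>; simplification
      turns the two predicates into x > 0 and x < 0 at the end.\<close>
    have "cp - 1 \<le> count_eigenvalues (\<lambda>x. 1 * x > 0) L"
      unfolding cp_def
    proof (rule components_le_count_eigenvalues[OF assms(2)])
      show "1 * \<gamma> e < 0" if "e \<in> edges G - pos_edges G" for e
        using that \<gamma> by (cases "sign_of G e") (auto simp: pos_edges_def consistent_weighting_def)
    qed (auto simp: pos_edges_def)
    moreover have "cn - 1 \<le> count_eigenvalues (\<lambda>x. - 1 * x > 0) L"
      unfolding cn_def
    proof (rule components_le_count_eigenvalues[OF assms(2)])
      show "- 1 * \<gamma> e < 0" if "e \<in> edges G - neg_edges G" for e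
        using that \<gamma> by (cases "sign_of G e") (auto simp: neg_edges_def consistent_weighting_def)
    qed (auto simp: neg_edges_def)
    ultimately show "t \<in> ?T"
      using zero_eigenvalue_count[OF n] eigenvalue_count_sum[OF laplacian_carrier laplacian_symmetric]
      by (simp add: t inertia_def)
  qed
  thus ?thesis
    using T finite_subset card_mono le_trans by meson
qed

end
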